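(* Let $n\ge2$, $0\le\mu<n/4$, $a>0$, and let $K_\mu$ be the modified Bessel function of the second kind of order $\mu$. Put $$f_{a,\mu}(x):=\Bigl(\frac{a}{|x|}\Bigr)^{\mu}K_\mu(a|x|),\qquad f_{a,\mu,\xi}(x):=f_{a,\mu}(x-\xi),\qquad x,\xi\in\mathbb{R}^n .$$ Then with $p:=\frac n2-2\mu>0$ the following equality holds for all $\xi,\eta\in\mathbb{R}^n$: $$\Bigl(\frac{|\xi-\eta|}{a}\Bigr)^pK_p(a|\xi-\eta|)=\frac{2^{\frac n2-2\mu}}{\pi^{\frac n2}B\bigl(\frac n2-\mu,\frac12\bigr)}\,\langle f_{a,\mu,\xi},f_{a,\mu,\eta}\rangle_{L^2(\mathbb{R}^n)} .$$
   Context: $B(x,y)=\Gamma(x)\Gamma(y)/\Gamma(x+y)$ is the Euler beta-function. For $\xi=\eta$ the left-hand side is understood as its limit as $|\xi-\eta|\to0$. *)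

theory Defs
  imports "HOL-Analysis.Analysis"
begin

(* Modified Bessel function of the second kind, of real order nu and argument z > 0, defined by
     K_nu(z) = integral over t in (0,infinity) of exp(-z cosh t) cosh(nu t)
   (Wendland, Scattered Data Approximation, Definition 5.10; also DLMF 10.32.9).
   The integral converges absolutely exactly for z > 0; only these arguments are meaningful. *)
definition bessel_K :: "real \<Rightarrow> real \<Rightarrow> real" where
  "bessel_K \<nu> z = (LBINT t:{0..}. exp (- z * cosh t) * cosh (\<nu> * t))"

(* The value at x = 0 is a junk value, irrelevant as {0} is a null set. *)
definition bessel_f :: "real \<Rightarrow> real \<Rightarrow> real ^ 'n \<Rightarrow> real" where
  "bessel_f a \<mu> x = (a / norm x) powr \<mu> * bessel_K \<mu> (a * norm x)"

definition bessel_f_shift :: "real \<Rightarrow> real \<Rightarrow> real ^ 'n \<Rightarrow> real ^ 'n \<Rightarrow> real" where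
  "bessel_f_shift a \<mu> \<xi> x = bessel_f a \<mu> (x - \<xi>)"

definition L2_fun :: "(real ^ 'n \<Rightarrow> real) \<Rightarrow> bool" where
  "L2_fun f \<longleftrightarrow> f \<in> borel_measurable lborel \<and> integrable lborel (\<lambda>x. (f x)\<^sup>2)"

(* The L2 inner product for real-valued functions, for which conjugation is vacuous. *)
definition L2_inner :: "(real ^ 'n \<Rightarrow> real) \<Rightarrow> (real ^ 'n \<Rightarrow> real) \<Rightarrow> real" where
  "L2_inner f g = (\<integral>x. f x * g x \<partial>lborel)"

end

theory Submission
  imports Defs "HOL-Probability.Distributions"
begin

text \<open>
  Both sides are mixtures of exponentials. Substituting in the integral representation of \<open>K\<close>,
  \<open>(a/r)\<^sup>\<mu> K\<^sub>\<mu>(a r)\<close> is a mixture over \<open>w > 0\<close> of the Gaussians \<open>exp (-w r\<^sup>2/2)\<close>, and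
  \<open>(r/a)\<^sup>p K\<^sub>p(a r)\<close> is a mixture over \<open>u > 0\<close> of \<open>exp (-r\<^sup>2/(2u))\<close>. The product of the Gaussians of
  weights \<open>w\<close> and \<open>v\<close> centred at \<open>\<xi>\<close> and \<open>\<eta>\<close> integrates to
  \<open>(2\<pi>/(w+v))\<close> to the power \<open>n/2\<close> times \<open>exp (-|\<xi>-\<eta>|\<^sup>2/(2u))\<close> with \<open>u = 1/w + 1/v\<close>. In the coordinates \<open>u\<close> and
  \<open>v/w\<close> the remaining double integral factors into the mixture for \<open>K\<^sub>p\<close> and the Euler integral
  \<open>B(n/2-\<mu>, n/2-\<mu>)\<close>, which the duplication formula turns into the stated constant.
\<close>

section \<open>Changes of variables for nonnegative integrals\<close>

lemma nn_integral_substitution_UNIV: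
  fixes f g g' :: "real \<Rightarrow> real"
  assumes int: "(f has_integral I) (range g)" and nonneg: "\<And>y. y \<in> range g \<Longrightarrow> 0 \<le> f y"
    and deriv: "\<And>x. (g has_real_derivative g' x) (at x)" and inj: "inj g"
    and g'_nonneg: "\<And>x. 0 \<le> g' x"
    and meas: "(\<lambda>x. g' x * f (g x)) \<in> borel_measurable borel"
  shows "(\<integral>\<^sup>+x. ennreal (g' x * f (g x)) \<partial>lborel) = ennreal I"
proof -
  \<comment> \<open>Nonnegativity upgrades gauge integrability to absolute integrability, the form
    in which an injective differentiable substitution preserves the value.\<close>
  have "f absolutely_integrable_on range g \<and> integral (range g) f = I"
    using int nonneg by (auto intro!: nonnegative_absolutely_integrable_1 dest: has_integral_integrable)
  then have "(\<lambda>x. \<bar>g' x\<bar> * f (g x)) absolutely_integrable_on UNIV \<and>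
      integral UNIV (\<lambda>x. \<bar>g' x\<bar> * f (g x)) = I"
    by (subst has_absolute_integral_change_of_variables_1') (use deriv inj in auto)
  then have "((\<lambda>x. g' x * f (g x)) has_integral I) UNIV"
    using g'_nonneg set_lebesgue_integral_eq_integral(1) by (force intro: integrable_integral simp: has_integral_iff)
  then show ?thesis
    by (intro nn_integral_has_integral_lborel meas) (auto simp: g'_nonneg nonneg)
qed

lemma nn_integral_translation:
  fixes f :: "'a :: euclidean_space \<Rightarrow> ennreal"
  assumes [measurable]: "f \<in> borel_measurable borel"
  shows "(\<integral>\<^sup>+x. f (c + x) \<partial>lborel) = (\<integral>\<^sup>+x. f x \<partial>lborel)"
proof -
  have "(\<integral>\<^sup>+x. f x \<partial>lborel) = (\<integral>\<^sup>+x. f x \<partial>distr lborel borel ((+) c))"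
    by (simp add: lborel_distr_plus)
  then show ?thesis
    by (simp add: nn_integral_distr)
qed

lemma nn_integral_reflection:
  fixes f :: "real \<Rightarrow> ennreal"
  assumes [measurable]: "f \<in> borel_measurable borel"
  shows "(\<integral>\<^sup>+x. f (- x) \<partial>lborel) = (\<integral>\<^sup>+x. f x \<partial>lborel)"
  using nn_integral_real_affine[of f "-1" 0] by simp

section \<open>Gaussian integrals\<close>

lemma nn_integral_gaussian_real:
  fixes s :: real
  assumes "s > 0"
  shows "(\<integral>\<^sup>+x. ennreal (exp (- (s * x\<^sup>2 / 2))) \<partial>lborel) = ennreal ((2 * pi / s) powr (1 / 2))"
proof -
  \<comment> \<open>This is the normal density of variance 1/s without its normalising
    factor.\<close>
  have density: "exp (- (s * x\<^sup>2 / 2)) = sqrt (2 * pi / s) * normal_density 0 (1 / sqrt s) x" for x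
    using assms by (simp add: normal_density_def real_sqrt_divide real_sqrt_mult power_divide field_simps)
  have "(\<integral>\<^sup>+x. ennreal (exp (- (s * x\<^sup>2 / 2))) \<partial>lborel) =
      ennreal (sqrt (2 * pi / s)) * (\<integral>\<^sup>+x. ennreal (normal_density 0 (1 / sqrt s) x) \<partial>lborel)"
    unfolding density using assms
    by (subst nn_integral_cmult[symmetric]) (auto simp: ennreal_mult')
  also have "(\<integral>\<^sup>+x. ennreal (normal_density 0 (1 / sqrt s) x) \<partial>lborel) = 1"
    using assms by (subst nn_integral_eq_integral) (auto simp: normal_density_nonneg)
  finally show ?thesis
    using assms by (simp add: powr_half_sqrt)
qed

text \<open>The Gaussian is a product over the orthonormal basis, so its integral is a product of
  one-dimensional ones.\<close>

lemma nn_integral_gaussian: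
  fixes s :: real
  assumes "s > 0"
  shows "(\<integral>\<^sup>+x. ennreal (exp (- (s * (norm (x :: 'a :: euclidean_space))\<^sup>2 / 2))) \<partial>lborel) =
    ennreal ((2 * pi / s) powr (real DIM('a) / 2))"
proof -
  have split: "exp (- (s * (norm x)\<^sup>2 / 2)) = (\<Prod>b\<in>Basis. exp (- (s * (x \<bullet> b)\<^sup>2 / 2)))" for x :: 'a
    unfolding euclidean_inner[of x x] power2_norm_eq_inner
    by (simp add: exp_sum[symmetric] sum_negf sum_divide_distrib sum_distrib_left power2_eq_square)
  have "(\<integral>\<^sup>+x. ennreal (exp (- (s * (norm (x :: 'a))\<^sup>2 / 2))) \<partial>lborel) =
      (\<integral>\<^sup>+x. (\<Prod>b\<in>Basis. ennreal (exp (- (s * ((x :: 'a) \<bullet> b)\<^sup>2 / 2)))) \<partial>lborel)"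
    unfolding split by (simp add: prod_ennreal)
  also have "\<dots> = (\<Prod>b\<in>(Basis :: 'a set). ennreal ((2 * pi / s) powr (1 / 2)))"
    using nn_integral_lborel_prod[where 'a='a, of "\<lambda>b x. ennreal (exp (- (s * x\<^sup>2 / 2)))"]
    by (simp add: nn_integral_gaussian_real[OF assms])
  also have "\<dots> = ennreal (((2 * pi / s) powr (1 / 2)) ^ DIM('a))"
    by (simp add: ennreal_power)
  also have "((2 * pi / s) powr (1 / 2)) ^ DIM('a) = (2 * pi / s) powr (real DIM('a) / 2)"
    using assms by (simp add: powr_powr powr_realpow[symmetric])
  finally show ?thesis .
qed

text \<open>Completing the square around the weighted barycentre \<open>c\<close> leaves a centred
  Gaussian of weight w + v and a constant factor in the distance of the two centres.\<close>

lemma nn_integral_gaussian_product: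
  fixes w v :: real and \<xi> \<eta> :: "'a :: euclidean_space"
  assumes "w > 0" "v > 0"
  shows "(\<integral>\<^sup>+x. ennreal (exp (- ((w * (norm (x - \<xi>))\<^sup>2 + v * (norm (x - \<eta>))\<^sup>2) / 2))) \<partial>lborel) =
    ennreal ((2 * pi / (w + v)) powr (real DIM('a) / 2) *
      exp (- (w * v / (w + v) * (norm (\<xi> - \<eta>))\<^sup>2 / 2)))"
proof -
  define c where "c = (1 / (w + v)) *\<^sub>R (w *\<^sub>R \<xi> + v *\<^sub>R \<eta>)"
  have pos: "w + v > 0" using assms by simp
  have square: "w * (norm (c + x - \<xi>))\<^sup>2 + v * (norm (c + x - \<eta>))\<^sup>2 =
      (w + v) * (norm x)\<^sup>2 + w * v / (w + v) * (norm (\<xi> - \<eta>))\<^sup>2" for x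
  proof -
    have 1: "c + x - \<xi> = x - (v / (w + v)) *\<^sub>R (\<xi> - \<eta>)"
    proof -
      have "c = (1 - v / (w + v)) *\<^sub>R \<xi> + (v / (w + v)) *\<^sub>R \<eta>"
        using pos by (simp add: c_def scaleR_add_right field_simps)
      then show ?thesis by (simp add: algebra_simps)
    qed
    have 2: "c + x - \<eta> = x + (w / (w + v)) *\<^sub>R (\<xi> - \<eta>)"
    proof -
      have "c = (w / (w + v)) *\<^sub>R \<xi> + (1 - w / (w + v)) *\<^sub>R \<eta>"
        using pos by (simp add: c_def scaleR_add_right field_simps)
      then show ?thesis by (simp add: algebra_simps)
    qed
    define d where "d = \<xi> - \<eta>"
    \<comment> \<open>The choice of the barycentre makes the coefficient of the cross term x . d
      vanish.\<close>
    have "w * (norm (c + x - \<xi>))\<^sup>2 + v * (norm (c + x - \<eta>))\<^sup>2 = (w + v) * (x \<bullet> x)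
       + (w * (v / (w + v))\<^sup>2 + v * (w / (w + v))\<^sup>2) * (d \<bullet> d)
       + 2 * (v * (w / (w + v)) - w * (v / (w + v))) * (x \<bullet> d)"
      unfolding 1 2 d_def[symmetric] power2_norm_eq_inner
      by (simp add: inner_diff inner_add inner_commute[of d x] algebra_simps power2_eq_square)
    also have "w * (v / (w + v))\<^sup>2 + v * (w / (w + v))\<^sup>2 = w * v * (w + v) / (w + v)\<^sup>2"
      by (simp add: power_divide power2_eq_square distrib_left add_divide_distrib mult_ac)
    also have "\<dots> = w * v / (w + v)"
      using pos by (simp add: power2_eq_square)
    finally show ?thesis
      by (simp add: d_def power2_norm_eq_inner mult.commute)
  qed
  have "(\<integral>\<^sup>+x. ennreal (exp (- ((w * (norm (x - \<xi>))\<^sup>2 + v * (norm (x - \<eta>))\<^sup>2) / 2))) \<partial>lborel) =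
      (\<integral>\<^sup>+x. ennreal (exp (- ((w * (norm (c + x - \<xi>))\<^sup>2 + v * (norm (c + x - \<eta>))\<^sup>2) / 2))) \<partial>lborel)"
    by (subst nn_integral_translation[where c=c, symmetric]) auto
  also have "\<dots> = (\<integral>\<^sup>+x. ennreal (exp (- (w * v / (w + v) * (norm (\<xi> - \<eta>))\<^sup>2 / 2))) *
      ennreal (exp (- ((w + v) * (norm (x :: 'a))\<^sup>2 / 2))) \<partial>lborel)"
    unfolding square by (simp add: ennreal_mult'[symmetric] exp_add[symmetric] add_divide_distrib add.commute)
  also have "\<dots> = ennreal (exp (- (w * v / (w + v) * (norm (\<xi> - \<eta>))\<^sup>2 / 2))) *
      ennreal ((2 * pi / (w + v)) powr (real DIM('a) / 2))"
    by (subst nn_integral_cmult) (auto simp: nn_integral_gaussian[OF pos])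
  finally show ?thesis
    by (simp add: ennreal_mult'[symmetric] mult.commute)
qed

section \<open>The Euler integral in logarithmic form and its duplication\<close>

lemma nn_integral_logistic:
  fixes \<alpha> :: real
  assumes "\<alpha> > 0"
  shows "(\<integral>\<^sup>+h. ennreal (exp (\<alpha> * h - 2 * \<alpha> * ln (1 + exp h))) \<partial>lborel) = ennreal (Beta \<alpha> \<alpha>)"
proof -
  \<comment> \<open>The logistic function maps the line bijectively onto (0,1) and has derivative
    g(1 - g), which raises both exponents \<alpha> - 1 of the Euler integrand to \<alpha>.\<close>
  define g where "g h = exp h / (1 + exp h)" for h :: real
  have pos: "1 + exp h > 0" for h :: real by (simp add: add_pos_pos)
  have g_pos: "g h > 0" and g_less: "g h < 1" for h
    using pos[of h] by (simp_all add: g_def)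
  have g_ln: "g (ln (y / (1 - y))) = y" if "0 < y" "y < 1" for y
    using that by (simp add: g_def field_simps)
  have range: "range g = {0<..<1}"
  proof (intro equalityI subsetI)
    fix y :: real assume "y \<in> {0<..<1}"
    then have "y = g (ln (y / (1 - y)))" using g_ln[of y] by simp
    then show "y \<in> range g" by (rule range_eqI)
  qed (use g_pos g_less in auto)
  have inj: "inj g"
  proof (rule injI)
    fix x y assume "g x = g y"
    then have "exp x = exp y"
      using pos[of x] pos[of y] by (simp add: g_def field_simps)
    then show "x = y" by simp
  qed
  have deriv: "(g has_real_derivative g h * (1 - g h)) (at h)" for h
    unfolding g_def using pos[of h]
    by (auto intro!: derivative_eq_intros simp: field_simps)
  have int: "((\<lambda>t. t powr (\<alpha> - 1) * (1 - t) powr (\<alpha> - 1)) has_integral Beta \<alpha> \<alpha>) (range g)"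
    unfolding range using has_integral_Beta_real[OF assms assms]
    by (simp add: has_integral_Icc_iff_Ioo)
  have "g h * (1 - g h) * (g h powr (\<alpha> - 1) * (1 - g h) powr (\<alpha> - 1)) =
      exp (\<alpha> * h - 2 * \<alpha> * ln (1 + exp h))" for h
  proof -
    have "g h * (1 - g h) * (g h powr (\<alpha> - 1) * (1 - g h) powr (\<alpha> - 1)) = g h powr \<alpha> * (1 - g h) powr \<alpha>"
      using g_pos[of h] g_less[of h] by (simp add: powr_diff)
    also have "\<dots> = exp (\<alpha> * (ln (g h) + ln (1 - g h)))"
      using g_pos[of h] g_less[of h] by (simp add: powr_def exp_add[symmetric] algebra_simps)
    also have "ln (g h) + ln (1 - g h) = h - 2 * ln (1 + exp h)"
    proof -
      have "1 - g h = 1 / (1 + exp h)"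
        using pos[of h] by (simp add: g_def field_simps)
      then show ?thesis
        using pos[of h] by (simp add: g_def ln_div)
    qed
    finally show ?thesis by (simp add: algebra_simps)
  qed
  moreover have "(\<integral>\<^sup>+h. ennreal (g h * (1 - g h) * (g h powr (\<alpha> - 1) * (1 - g h) powr (\<alpha> - 1))) \<partial>lborel) =
      ennreal (Beta \<alpha> \<alpha>)"
    by (rule nn_integral_substitution_UNIV[OF int _ deriv inj])
       (use g_pos g_less in \<open>auto simp: less_imp_le g_def\<close>)
  ultimately show ?thesis by simp
qed

text \<open>Expanding the fraction by \<Gamma>(\<alpha> + 1/2) lets Legendre's formula cancel
  \<Gamma>(2\<alpha>); what remains is B(\<alpha>, 1/2), since \<Gamma>(1/2) is the square root of
  \<pi>.\<close>

lemma Beta_duplication: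
  fixes \<alpha> :: real
  assumes "\<alpha> > 0"
  shows "Beta \<alpha> \<alpha> = 2 powr (1 - 2 * \<alpha>) * Beta \<alpha> (1 / 2)"
proof -
  \<comment> \<open>Legendre's formula is applied at a complex argument, where the poles of \<Gamma>
    must be excluded, and then read off on the reals.\<close>
  have nonpos: "complex_of_real x \<notin> \<int>\<^sub>\<le>\<^sub>0" if "x > 0" for x
    using that by (auto elim!: nonpos_Ints_cases simp: complex_eq_iff)
  have "complex_of_real (Gamma \<alpha> * Gamma (\<alpha> + 1 / 2)) =
      complex_of_real (exp ((1 - 2 * \<alpha>) * ln 2) * sqrt pi * Gamma (2 * \<alpha>))"
    using Gamma_legendre_duplication[of "complex_of_real \<alpha>"] nonpos[of \<alpha>] nonpos[of "\<alpha> + 1/2"] assms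
    by (simp add: Gamma_complex_of_real[symmetric] exp_of_real[symmetric])
  then have dup: "Gamma \<alpha> * Gamma (\<alpha> + 1 / 2) = 2 powr (1 - 2 * \<alpha>) * sqrt pi * Gamma (2 * \<alpha>)"
    by (simp only: of_real_eq_iff powr_def) simp
  have pos: "Gamma (\<alpha> + 1 / 2) > 0" "Gamma (2 * \<alpha>) > 0"
    using assms by (auto intro!: Gamma_real_pos)
  have "Beta \<alpha> \<alpha> = Gamma \<alpha> * (Gamma \<alpha> * Gamma (\<alpha> + 1 / 2)) / (Gamma (2 * \<alpha>) * Gamma (\<alpha> + 1 / 2))"
    unfolding Beta_def mult_2[symmetric] using pos(1) by simp
  also have "\<dots> = 2 powr (1 - 2 * \<alpha>) * (Gamma \<alpha> * sqrt pi / Gamma (\<alpha> + 1 / 2))"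
    unfolding dup using pos by simp
  finally show ?thesis
    by (simp only: Beta_def Gamma_one_half_real)
qed

lemma Beta_pos:
  fixes x y :: real
  assumes "x > 0" "y > 0"
  shows "Beta x y > 0"
  using assms by (simp add: Beta_def Gamma_real_pos)

section \<open>The two-weight integral: symmetries and finiteness\<close>

text \<open>
  The logarithmic form (\<open>u = e\<^sup>t\<close>) of \<open>\<integral> u\<^sup>\<alpha>\<^sup>-\<^sup>1 e\<^sup>-\<^sup>(\<^sup>c\<^sup>u\<^sup>+\<^sup>d\<^sup>/\<^sup>u\<^sup>)\<^sup>/\<^sup>2 du\<close> over \<open>(0, \<infinity>)\<close>:
  scalings of \<open>u\<close> become translations of \<open>t\<close>, so that Tonelli's theorem and translation
  invariance replace all multiplicative changes of variables.
\<close>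

definition bessel_int :: "real \<Rightarrow> real \<Rightarrow> real \<Rightarrow> ennreal" where
  "bessel_int \<alpha> c d = (\<integral>\<^sup>+t. ennreal (exp (\<alpha> * t - (c * exp t + d * exp (- t)) / 2)) \<partial>lborel)"

lemma bessel_int_uminus: "bessel_int (- \<alpha>) c d = bessel_int \<alpha> d c"
  unfolding bessel_int_def
  by (subst nn_integral_reflection[symmetric]) (auto simp: add.commute)

text \<open>Translate t by k. A suitable k makes two positive weights equal, or normalises c when d
  = 0.\<close>

lemma bessel_int_scale:
  "bessel_int \<alpha> (c * exp k) (d * exp (- k)) = ennreal (exp (- (\<alpha> * k))) * bessel_int \<alpha> c d"
proof -
  have "bessel_int \<alpha> (c * exp k) (d * exp (- k)) =
      (\<integral>\<^sup>+t. ennreal (exp (- (\<alpha> * k)) * exp (\<alpha> * (k + t) - (c * exp (k + t) + d * exp (- (k + t))) / 2)) \<partial>lborel)"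
    unfolding bessel_int_def
    by (simp add: exp_add[symmetric] exp_diff[symmetric] mult_exp_exp algebra_simps)
  also have "\<dots> = ennreal (exp (- (\<alpha> * k))) *
      (\<integral>\<^sup>+t. ennreal (exp (\<alpha> * (k + t) - (c * exp (k + t) + d * exp (- (k + t))) / 2)) \<partial>lborel)"
    by (subst nn_integral_cmult[symmetric]) (auto simp: ennreal_mult')
  also have "(\<integral>\<^sup>+t. ennreal (exp (\<alpha> * (k + t) - (c * exp (k + t) + d * exp (- (k + t))) / 2)) \<partial>lborel) = bessel_int \<alpha> c d"
    unfolding bessel_int_def by (rule nn_integral_translation) measurable
  finally show ?thesis .
qed

lemma bessel_int_antimono: "d \<le> d' \<Longrightarrow> bessel_int \<alpha> c d' \<le> bessel_int \<alpha> c d"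
  unfolding bessel_int_def by (intro nn_integral_mono) (auto intro!: mult_right_mono)

text \<open>Replacing d by 0 only enlarges the integral, and scaling c to 2 then gives
  \<Gamma>(\<alpha>). Positivity of \<alpha> gives decay at minus infinity even for d = 0.\<close>

lemma bessel_int_finite:
  assumes "\<alpha> > 0" "c > 0" "d \<ge> 0"
  shows "bessel_int \<alpha> c d < \<infinity>"
proof -
  have range: "range (exp :: real \<Rightarrow> real) = {0<..}"
    by (auto simp: image_iff intro: exp_ln[symmetric])
  have "((\<lambda>t. t powr (\<alpha> - 1) / exp t) has_integral Gamma \<alpha>) (range exp)"
  proof -
    \<comment> \<open>The endpoint 0 lies outside the range of \<open>exp\<close> and is dropped as
      a null set.\<close>
    have "((\<lambda>t. if t \<in> {0<..} then t powr (\<alpha> - 1) / exp t else 0) has_integral Gamma \<alpha>) {0..}"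
      by (rule has_integral_spike[OF _ _ Gamma_integral_real[OF assms(1)], of "{0}"]) auto
    also have "?this = ?thesis"
      unfolding range by (subst has_integral_restrict) auto
    finally show ?thesis .
  qed
  then have "(\<integral>\<^sup>+x. ennreal (exp x * (exp x powr (\<alpha> - 1) / exp (exp x))) \<partial>lborel) = ennreal (Gamma \<alpha>)"
    by (rule nn_integral_substitution_UNIV[where g' = exp])
       (auto intro!: derivative_eq_intros injI)
  also have "(\<lambda>x :: real. exp x * (exp x powr (\<alpha> - 1) / exp (exp x))) =
      (\<lambda>x. exp (\<alpha> * x - (2 * exp x + 0 * exp (- x)) / 2))"
    by (auto simp: powr_def exp_diff[symmetric] mult_exp_exp algebra_simps)
  finally have "bessel_int \<alpha> 2 0 < \<infinity>"
    unfolding bessel_int_def by simp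
  moreover have "bessel_int \<alpha> (2 * exp (ln (c / 2))) (0 * exp (- ln (c / 2))) =
      ennreal (exp (- (\<alpha> * ln (c / 2)))) * bessel_int \<alpha> 2 0"
    by (rule bessel_int_scale)
  moreover have "2 * exp (ln (c / 2)) = c"
    using assms by simp
  ultimately have "bessel_int \<alpha> c 0 < \<infinity>"
    by (simp add: ennreal_mult_less_top)
  then show ?thesis
    by (rule le_less_trans[OF bessel_int_antimono[OF assms(3)]])
qed

section \<open>From the two-weight integral to the Bessel function\<close>

lemma nn_integral_bessel_K:
  "bessel_int \<nu> z z =
    2 * (\<integral>\<^sup>+t. ennreal (exp (- z * cosh t) * cosh (\<nu> * t) * indicator {0..} t) \<partial>lborel)"
proof -
  define f where "f t = exp (\<nu> * t - (z * exp t + z * exp (- t)) / 2)" for t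
  have [measurable]: "f \<in> borel_measurable borel"
    unfolding f_def by measurable
  \<comment> \<open>The line is folded at 0, so that t and -t combine to a hyperbolic cosine. The
    point 0 would be counted twice, hence the almost-everywhere argument below.\<close>
  have split: "ennreal (f t) = ennreal (f t) * indicator {0..} t + ennreal (f t) * indicator {0..} (- t)"
    if "t \<noteq> 0" for t
    using that by (auto simp: indicator_def)
  have "bessel_int \<nu> z z =
      (\<integral>\<^sup>+t. ennreal (f t) * indicator {0..} t + ennreal (f t) * indicator {0..} (- t) \<partial>lborel)"
    unfolding bessel_int_def f_def[symmetric]
    by (rule nn_integral_cong_AE, rule AE_mp[OF AE_lborel_singleton[of 0]])
       (use split in auto)
  also have "\<dots> = (\<integral>\<^sup>+t. ennreal (f t) * indicator {0..} t \<partial>lborel) +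
      (\<integral>\<^sup>+t. ennreal (f t) * indicator {0..} (- t) \<partial>lborel)"
    by (rule nn_integral_add) auto
  also have "(\<integral>\<^sup>+t. ennreal (f t) * indicator {0..} (- t) \<partial>lborel) =
      (\<integral>\<^sup>+t. ennreal (f (- t)) * indicator {0..} t \<partial>lborel)"
    by (subst nn_integral_reflection[symmetric]) auto
  also have "(\<integral>\<^sup>+t. ennreal (f t) * indicator {0..} t \<partial>lborel) + \<dots> =
      (\<integral>\<^sup>+t. ennreal (f t) * indicator {0..} t + ennreal (f (- t)) * indicator {0..} t \<partial>lborel)"
    by (rule nn_integral_add[symmetric]) auto
  also have "\<dots> = (\<integral>\<^sup>+t. 2 * ennreal (exp (- z * cosh t) * cosh (\<nu> * t) * indicator {0..} t) \<partial>lborel)"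
  proof (rule nn_integral_cong)
    fix t
    have "f t + f (- t) = 2 * (exp (- z * cosh t) * cosh (\<nu> * t))"
    proof -
      have "(z * exp t + z * exp (- t)) / 2 = z * cosh t"
        by (simp add: cosh_def field_simps)
      then have "f t = exp (- z * cosh t) * exp (\<nu> * t)" "f (- t) = exp (- z * cosh t) * exp (- (\<nu> * t))"
        by (simp_all add: f_def mult_exp_exp add.commute)
      then show ?thesis
        by (simp add: cosh_def distrib_left)
    qed
    moreover have "f t \<ge> 0" "f (- t) \<ge> 0"
      by (auto simp: f_def)
    ultimately have "ennreal (f t) + ennreal (f (- t)) = 2 * ennreal (exp (- z * cosh t) * cosh (\<nu> * t))"
      by (simp add: ennreal_plus[symmetric] ennreal_mult' del: ennreal_plus)
    then show "ennreal (f t) * indicator {0..} t + ennreal (f (- t)) * indicator {0..} t =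
        2 * ennreal (exp (- z * cosh t) * cosh (\<nu> * t) * indicator {0..} t)"
      by (auto simp: indicator_def)
  qed
  also have "\<dots> = 2 * (\<integral>\<^sup>+t. ennreal (exp (- z * cosh t) * cosh (\<nu> * t) * indicator {0..} t) \<partial>lborel)"
    by (rule nn_integral_cmult) (auto simp: cosh_def)
  finally show ?thesis .
qed

text \<open>Since cosh increases on the half-line, finiteness passes from a larger order to a
  smaller one; this reaches order 0, where the \<Gamma> bound does not apply.\<close>

lemma bessel_int_mono_order:
  assumes "0 \<le> \<nu>" "\<nu> \<le> \<nu>'"
  shows "bessel_int \<nu> z z \<le> bessel_int \<nu>' z z"
proof -
  have "cosh (\<nu> * t) \<le> cosh (\<nu>' * t)" if "t \<ge> 0" for t
    using assms that by (intro cosh_real_nonneg_le_iff[THEN iffD2]) (auto intro: mult_right_mono)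
  then show ?thesis
    unfolding nn_integral_bessel_K
    by (intro mult_left_mono nn_integral_mono) (auto simp: indicator_def intro!: ennreal_leI)
qed

lemma bessel_int_eq_finite:
  assumes "z > 0" "\<nu> \<ge> 0"
  shows "bessel_int \<nu> z z < \<infinity>"
  using bessel_int_mono_order[of \<nu> "\<nu> + 1" z] bessel_int_finite[of "\<nu> + 1" z z] assms by auto

lemma bessel_K_nonneg: "bessel_K \<nu> z \<ge> 0"
  unfolding bessel_K_def set_lebesgue_integral_def by (rule Bochner_Integration.integral_nonneg) (simp add: cosh_def)

text \<open>Finiteness shows that \<open>bessel_K\<close> is a genuine integral here and not the
  default value 0.\<close>

lemma bessel_int_eq_bessel_K:
  assumes "z > 0" "\<nu> \<ge> 0"
  shows "bessel_int \<nu> z z = ennreal (2 * bessel_K \<nu> z)"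
proof -
  let ?f = "\<lambda>t. exp (- z * cosh t) * cosh (\<nu> * t) * indicator {0..} t"
  have "2 * (\<integral>\<^sup>+t. ennreal (?f t) \<partial>lborel) < \<infinity>"
    using bessel_int_eq_finite[OF assms] by (simp only: nn_integral_bessel_K)
  then have "(\<integral>\<^sup>+t. ennreal (?f t) \<partial>lborel) < \<infinity>"
    by (auto simp: ennreal_mult_less_top)
  then have int: "integrable lborel ?f"
    by (intro integrableI_nonneg) (auto simp: cosh_def)
  have "bessel_K \<nu> z = (\<integral>t. ?f t \<partial>lborel)"
    by (simp add: bessel_K_def set_lebesgue_integral_def mult.commute)
  moreover have "ennreal (\<integral>t. ?f t \<partial>lborel) = (\<integral>\<^sup>+t. ennreal (?f t) \<partial>lborel)"
    by (rule nn_integral_eq_integral[symmetric, OF int]) (auto simp: cosh_def)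
  ultimately show ?thesis
    by (simp only: nn_integral_bessel_K) (simp add: ennreal_mult')
qed

lemma bessel_int_eq_powr_bessel_K:
  assumes "a > 0" "r > 0" "\<nu> \<ge> 0"
  shows "bessel_int \<nu> (r\<^sup>2) (a\<^sup>2) = ennreal (2 * ((a / r) powr \<nu> * bessel_K \<nu> (a * r)))"
proof -
  \<comment> \<open>This shift balances the weights: both become a r up to the factors exp k and exp
    (-k).\<close>
  define k where "k = ln (r / a)"
  have "r\<^sup>2 = a * r * exp k" "a\<^sup>2 = a * r * exp (- k)"
    using assms by (auto simp: k_def exp_minus power2_eq_square)
  then have "bessel_int \<nu> (r\<^sup>2) (a\<^sup>2) = ennreal (exp (- (\<nu> * k))) * bessel_int \<nu> (a * r) (a * r)"
    by (simp only: bessel_int_scale)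
  also have "exp (- (\<nu> * k)) = (a / r) powr \<nu>"
    using assms by (simp add: k_def powr_def ln_div algebra_simps)
  finally show ?thesis
    using assms by (simp add: bessel_int_eq_bessel_K ennreal_mult'[symmetric] mult.left_commute)
qed

lemma bessel_int_eq_bessel_f:
  assumes "a > 0" "\<mu> \<ge> 0" "x \<noteq> 0"
  shows "bessel_int \<mu> ((norm x)\<^sup>2) (a\<^sup>2) = ennreal (2 * bessel_f a \<mu> x)"
  unfolding bessel_f_def using assms by (intro bessel_int_eq_powr_bessel_K) auto

lemma bessel_f_nonneg: "bessel_f a \<mu> x \<ge> 0"
  by (simp add: bessel_f_def bessel_K_nonneg)

lemma bessel_f_measurable [measurable]: "bessel_f a \<mu> \<in> borel_measurable borel"
proof -
  have [measurable]: "bessel_K \<mu> \<in> borel_measurable borel"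
    unfolding bessel_K_def set_lebesgue_integral_def cosh_def by measurable
  show ?thesis unfolding bessel_f_def by measurable
qed

text \<open>This supplies the limit for coinciding centres. The integrand decreases in d, so its
  value at d = 0 is an integrable majorant for dominated convergence.\<close>

lemma bessel_int_tendsto:
  assumes "\<alpha> > 0" "a > 0"
  shows "((\<lambda>r. enn2real (bessel_int \<alpha> (a\<^sup>2) (r\<^sup>2))) \<longlongrightarrow> enn2real (bessel_int \<alpha> (a\<^sup>2) 0)) (at_right 0)"
proof -
  define g where "g d t = exp (\<alpha> * t - (a\<^sup>2 * exp t + d * exp (- t)) / 2)" for d t
  have [measurable]: "g d \<in> borel_measurable borel" for d
    unfolding g_def by measurable
  have g_nonneg: "g d t \<ge> 0" for d t
    by (simp add: g_def)
  have int: "integrable lborel (g 0)"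
    using bessel_int_finite[of \<alpha> "a\<^sup>2" 0] assms
    by (intro integrableI_nonneg) (auto simp: g_def bessel_int_def)
  have bessel_int: "enn2real (bessel_int \<alpha> (a\<^sup>2) d) = (\<integral>t. g d t \<partial>lborel)" for d
    unfolding bessel_int_def g_def[symmetric]
    by (rule integral_eq_nn_integral[symmetric]) (auto simp: g_nonneg)
  show ?thesis
    unfolding bessel_int
  proof (subst tendsto_at_iff_sequentially, intro allI impI)
    fix X :: "nat \<Rightarrow> real" assume X: "\<forall>i. X i \<in> {0<..} - {0}" "X \<longlonglongrightarrow> 0"
    have "(\<lambda>i. \<integral>t. g ((X i)\<^sup>2) t \<partial>lborel) \<longlonglongrightarrow> (\<integral>t. g 0 t \<partial>lborel)"
    proof (rule integral_dominated_convergence[where w = "g 0"])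
      have "(\<lambda>i. g ((X i)\<^sup>2) t) \<longlonglongrightarrow> g (0\<^sup>2) t" for t
        unfolding g_def by (intro tendsto_intros X) simp
      then show "AE t in lborel. (\<lambda>i. g ((X i)\<^sup>2) t) \<longlonglongrightarrow> g 0 t"
        by simp
      show "AE t in lborel. norm (g ((X i)\<^sup>2) t) \<le> g 0 t" for i
        by (simp add: g_def)
    qed (use int in auto)
    then show "((\<lambda>r. \<integral>t. g (r\<^sup>2) t \<partial>lborel) \<circ> X) \<longlonglongrightarrow> (\<integral>t. g 0 t \<partial>lborel)"
      by (simp add: comp_def)
  qed
qed

text \<open>All integrands are nonnegative, so Tonelli allows integrating first over x, then over
  the common scale t, and last over the log-ratio h of the two weights.\<close>

lemma nn_integral_bessel_int_product:
  fixes \<xi> \<eta> :: "'a :: euclidean_space" and \<mu> a :: real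
  defines "\<alpha> \<equiv> real DIM('a) / 2 - \<mu>"
  assumes "\<alpha> > 0"
  shows "(\<integral>\<^sup>+x. bessel_int \<mu> ((norm (x - \<xi>))\<^sup>2) (a\<^sup>2) * bessel_int \<mu> ((norm (x - \<eta>))\<^sup>2) (a\<^sup>2) \<partial>lborel) =
    ennreal ((2 * pi) powr (real DIM('a) / 2) * Beta \<alpha> \<alpha>) *
    bessel_int (real DIM('a) / 2 - 2 * \<mu>) (a\<^sup>2) ((norm (\<xi> - \<eta>))\<^sup>2)"
proof -
  define n where "n = real DIM('a)"
  define p where "p = n / 2 - 2 * \<mu>"
  define \<rho> where "\<rho> = norm (\<xi> - \<eta>)"
  define e where "e y x t = exp (\<mu> * t - ((norm (x - y))\<^sup>2 * exp t + a\<^sup>2 * exp (- t)) / 2)"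
    for x y :: 'a and t :: real
  \<comment> \<open>\<open>P t s\<close> is the value of the x-integral for weights w = exp t and v
    = exp s, with wv/(w+v) written as 1/(1/w + 1/v).\<close>
  define P where "P t s = (2 * pi / (exp t + exp s)) powr (n / 2) *
      exp (\<mu> * (t + s) - a\<^sup>2 * (exp (- t) + exp (- s)) / 2 - \<rho>\<^sup>2 / (exp (- t) + exp (- s)) / 2)"
    for t s :: real
  have [measurable]: "(\<lambda>(x, t). e y x t) \<in> borel_measurable (borel \<Otimes>\<^sub>M borel)" for y
    unfolding e_def by measurable
  have [measurable]: "(\<lambda>(t, s). P t s) \<in> borel_measurable (borel \<Otimes>\<^sub>M borel)"
    unfolding P_def by measurable
  have e_nonneg: "e y x t \<ge> 0" for x y t
    by (simp add: e_def)
  have prod: "bessel_int \<mu> ((norm (x - \<xi>))\<^sup>2) (a\<^sup>2) * bessel_int \<mu> ((norm (x - \<eta>))\<^sup>2) (a\<^sup>2) =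
      (\<integral>\<^sup>+t. \<integral>\<^sup>+s. ennreal (e \<xi> x t * e \<eta> x s) \<partial>lborel \<partial>lborel)" for x
    unfolding bessel_int_def e_def[symmetric]
    by (simp add: nn_integral_cmult nn_integral_multc ennreal_mult' e_nonneg)
  have gauss: "(\<integral>\<^sup>+x. ennreal (e \<xi> x t * e \<eta> x s) \<partial>lborel) = ennreal (P t s)" for t s
  proof -
    let ?c = "exp (\<mu> * (t + s) - a\<^sup>2 * (exp (- t) + exp (- s)) / 2)"
    have "e \<xi> x t * e \<eta> x s =
        ?c * exp (- ((exp t * (norm (x - \<xi>))\<^sup>2 + exp s * (norm (x - \<eta>))\<^sup>2) / 2))" for x
      unfolding e_def mult_exp_exp by (rule arg_cong[where f = exp]) (simp add: field_simps)
    then have "(\<integral>\<^sup>+x. ennreal (e \<xi> x t * e \<eta> x s) \<partial>lborel) = ennreal ?c *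
        (\<integral>\<^sup>+x. ennreal (exp (- ((exp t * (norm (x - \<xi>))\<^sup>2 + exp s * (norm (x - \<eta>))\<^sup>2) / 2))) \<partial>lborel)"
      by (simp add: ennreal_mult' nn_integral_cmult)
    also have "\<dots> = ennreal (?c * ((2 * pi / (exp t + exp s)) powr (n / 2) *
        exp (- (exp t * exp s / (exp t + exp s) * \<rho>\<^sup>2 / 2))))"
      by (simp add: nn_integral_gaussian_product ennreal_mult' n_def \<rho>_def)
    also have "exp t * exp s / (exp t + exp s) * \<rho>\<^sup>2 / 2 = \<rho>\<^sup>2 / (exp (- t) + exp (- s)) / 2"
      using add_pos_pos[OF exp_gt_zero exp_gt_zero, of t s] by (simp add: exp_minus field_simps)
    also have "?c * ((2 * pi / (exp t + exp s)) powr (n / 2) * exp (- (\<rho>\<^sup>2 / (exp (- t) + exp (- s)) / 2))) = P t s"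
      by (subst mult.left_commute) (simp only: P_def mult_exp_exp diff_conv_add_uminus)
    finally show ?thesis .
  qed
  \<comment> \<open>The translation by \<open>ln (1 + e\<^sup>-\<^sup>h)\<close> turns \<open>e\<^sup>-\<^sup>t + e\<^sup>-\<^sup>(\<^sup>t\<^sup>+\<^sup>h\<^sup>)\<close> into \<open>e\<^sup>-\<^sup>t\<close>, which separates the variables.\<close>
  have shift: "P (ln (1 + exp h) - h + t) (ln (1 + exp h) - h + t + h) =
      (2 * pi) powr (n / 2) * (exp (\<alpha> * h - 2 * \<alpha> * ln (1 + exp h)) *
        exp (- p * t - (\<rho>\<^sup>2 * exp t + a\<^sup>2 * exp (- t)) / 2))" for h t
  proof -
    define L where "L = ln (1 + exp h)"
    have expL: "exp L = 1 + exp h"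
      by (simp add: L_def add_pos_pos)
    have "exp (L - h + t) + exp (L - h + t + h) = exp (L - h + t) * exp L"
      unfolding expL by (simp add: distrib_left mult_exp_exp add_ac)
    then have 1: "exp (L - h + t) + exp (L - h + t + h) = exp (t - h + 2 * L)"
      by (simp add: mult_exp_exp)
    have "exp (- (L - h + t)) + exp (- (L - h + t + h)) = exp (- t - L) * exp L"
      unfolding expL by (simp add: distrib_left mult_exp_exp algebra_simps)
    then have 2: "exp (- (L - h + t)) + exp (- (L - h + t + h)) = exp (- t)"
      by (simp add: mult_exp_exp)
    have 3: "(2 * pi / exp (t - h + 2 * L)) powr (n / 2) =
        (2 * pi) powr (n / 2) * exp (- (n / 2) * (t - h + 2 * L))"
    proof -
      have "exp (t - h + 2 * L) powr (n / 2) = exp (n / 2 * (t - h + 2 * L))"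
        by (simp add: powr_def)
      then show ?thesis
        unfolding powr_divide by (simp only: mult_minus_left exp_minus divide_inverse[of "_ powr _"])
    qed
    have "P (L - h + t) (L - h + t + h) = (2 * pi) powr (n / 2) *
        exp (- (n / 2) * (t - h + 2 * L) +
          (\<mu> * (L - h + t + (L - h + t + h)) - a\<^sup>2 * exp (- t) / 2 - \<rho>\<^sup>2 / exp (- t) / 2))"
      unfolding P_def 1 2 3 by (simp only: mult.assoc mult_exp_exp add_diff_eq)
    \<comment> \<open>Collecting coefficients: t gets 2\<mu> - n/2 = -p, h gets n/2 - \<mu> =
      \<alpha>, and L gets 2\<mu> - n = -2\<alpha>.\<close>
    also have "- (n / 2) * (t - h + 2 * L) +
          (\<mu> * (L - h + t + (L - h + t + h)) - a\<^sup>2 * exp (- t) / 2 - \<rho>\<^sup>2 / exp (- t) / 2) =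
        (\<alpha> * h - 2 * \<alpha> * L) + (- p * t - (\<rho>\<^sup>2 * exp t + a\<^sup>2 * exp (- t)) / 2)"
    proof -
      have "\<rho>\<^sup>2 / exp (- t) = \<rho>\<^sup>2 * exp t"
        by (simp add: exp_minus divide_inverse)
      then show ?thesis
        by (simp add: \<alpha>_def p_def n_def[symmetric] algebra_simps add_divide_distrib diff_divide_distrib)
    qed
    finally show ?thesis
      unfolding L_def exp_add .
  qed
  have "(\<integral>\<^sup>+x. bessel_int \<mu> ((norm (x - \<xi>))\<^sup>2) (a\<^sup>2) * bessel_int \<mu> ((norm (x - \<eta>))\<^sup>2) (a\<^sup>2) \<partial>lborel) =
      (\<integral>\<^sup>+x. \<integral>\<^sup>+t. \<integral>\<^sup>+s. ennreal (e \<xi> x t * e \<eta> x s) \<partial>lborel \<partial>lborel \<partial>lborel)"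
    unfolding prod ..
  also have "\<dots> = (\<integral>\<^sup>+t. \<integral>\<^sup>+x. \<integral>\<^sup>+s. ennreal (e \<xi> x t * e \<eta> x s) \<partial>lborel \<partial>lborel \<partial>lborel)"
    by (rule lborel_pair.Fubini') measurable
  also have "\<dots> = (\<integral>\<^sup>+t. \<integral>\<^sup>+s. \<integral>\<^sup>+x. ennreal (e \<xi> x t * e \<eta> x s) \<partial>lborel \<partial>lborel \<partial>lborel)"
    by (intro nn_integral_cong lborel_pair.Fubini') measurable
  also have "\<dots> = (\<integral>\<^sup>+t. \<integral>\<^sup>+s. ennreal (P t s) \<partial>lborel \<partial>lborel)"
    unfolding gauss ..
  \<comment> \<open>For fixed t, put s = t + h, so that h = ln (v/w).\<close>
  also have "\<dots> = (\<integral>\<^sup>+t. \<integral>\<^sup>+h. ennreal (P t (t + h)) \<partial>lborel \<partial>lborel)"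
    by (intro nn_integral_cong nn_integral_translation[symmetric]) measurable
  also have "\<dots> = (\<integral>\<^sup>+h. \<integral>\<^sup>+t. ennreal (P t (t + h)) \<partial>lborel \<partial>lborel)"
    by (rule lborel_pair.Fubini') measurable
  also have "\<dots> = (\<integral>\<^sup>+h. \<integral>\<^sup>+t. ennreal (P (ln (1 + exp h) - h + t) (ln (1 + exp h) - h + t + h)) \<partial>lborel \<partial>lborel)"
    by (intro nn_integral_cong
          nn_integral_translation[where f = "\<lambda>t. ennreal (P t (t + h))" for h, symmetric]) measurable
  also have "\<dots> = (\<integral>\<^sup>+h. \<integral>\<^sup>+t. ennreal ((2 * pi) powr (n / 2)) * (ennreal (exp (\<alpha> * h - 2 * \<alpha> * ln (1 + exp h))) *
      ennreal (exp (- p * t - (\<rho>\<^sup>2 * exp t + a\<^sup>2 * exp (- t)) / 2))) \<partial>lborel \<partial>lborel)"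
    by (intro nn_integral_cong, subst shift) (simp add: ennreal_mult')
  \<comment> \<open>The translated t is -ln u with u = 1/w + 1/v, which explains the order -p;
    reflection restores p and swaps the weights.\<close>
  also have "\<dots> = ennreal ((2 * pi) powr (n / 2)) * (ennreal (Beta \<alpha> \<alpha>) * bessel_int (- p) (\<rho>\<^sup>2) (a\<^sup>2))"
    unfolding bessel_int_def nn_integral_logistic[OF assms(2), symmetric]
    by (simp add: nn_integral_cmult nn_integral_multc)
  finally show ?thesis
    unfolding bessel_int_uminus
    by (simp add: ennreal_mult' n_def p_def \<rho>_def mult.assoc)
qed

section \<open>The inner product, its constant and the diagonal limit\<close>

theorem proposition4p13:
  fixes a \<mu> p :: real
  assumes "CARD('n::finite) \<ge> 2"
    and "0 \<le> \<mu>" and "\<mu> < real CARD('n) / 4"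
    and "a > 0"
    and "p = real CARD('n) / 2 - 2 * \<mu>"
  shows "p > 0 \<and>
    (\<forall>\<xi> :: real ^ 'n. L2_fun (bessel_f_shift a \<mu> \<xi>)) \<and>
    (\<forall>\<xi> \<eta> :: real ^ 'n.
       let R = 2 powr (real CARD('n) / 2 - 2 * \<mu>)
               / (pi powr (real CARD('n) / 2) * Beta (real CARD('n) / 2 - \<mu>) (1 / 2))
               * L2_inner (bessel_f_shift a \<mu> \<xi>) (bessel_f_shift a \<mu> \<eta>)
       in (\<xi> \<noteq> \<eta> \<longrightarrow>
             (norm (\<xi> - \<eta>) / a) powr p * bessel_K p (a * norm (\<xi> - \<eta>)) = R) \<and>
          (\<xi> = \<eta> \<longrightarrow>
             ((\<lambda>r. (r / a) powr p * bessel_K p (a * r)) \<longlongrightarrow> R) (at_right 0)))"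
proof -
  define n where "n = real CARD('n)"
  define \<alpha> where "\<alpha> = n / 2 - \<mu>"
  define C where "C = (2 * pi) powr (n / 2) * Beta \<alpha> \<alpha>"
  let ?f = "bessel_f_shift a \<mu> :: real ^ 'n \<Rightarrow> real ^ 'n \<Rightarrow> real"
  have p: "p > 0" and \<alpha>: "\<alpha> > 0"
    using assms by (auto simp: \<alpha>_def n_def)
  have C: "C > 0"
    unfolding C_def using \<alpha> by (intro mult_pos_pos Beta_pos) auto
  have [measurable]: "?f \<xi> \<in> borel_measurable borel" for \<xi>
    unfolding bessel_f_shift_def by measurable
  have f_nonneg: "?f \<xi> x \<ge> 0" for \<xi> x
    by (simp add: bessel_f_shift_def bessel_f_nonneg)
  \<comment> \<open>The factor 4 arises because each two-weight integral is twice the corresponding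
    \<open>bessel_f\<close>.\<close>
  have inner: "4 * (\<integral>\<^sup>+x. ennreal (?f \<xi> x * ?f \<eta> x) \<partial>lborel) =
      ennreal C * bessel_int p (a\<^sup>2) ((norm (\<xi> - \<eta>))\<^sup>2)" for \<xi> \<eta>
  proof -
    have "4 * (\<integral>\<^sup>+x. ennreal (?f \<xi> x * ?f \<eta> x) \<partial>lborel) = (\<integral>\<^sup>+x. 4 * ennreal (?f \<xi> x * ?f \<eta> x) \<partial>lborel)"
      by (rule nn_integral_cmult[symmetric]) measurable
    also have "\<dots> = (\<integral>\<^sup>+x. bessel_int \<mu> ((norm (x - \<xi>))\<^sup>2) (a\<^sup>2) * bessel_int \<mu> ((norm (x - \<eta>))\<^sup>2) (a\<^sup>2) \<partial>lborel)"
    proof (rule nn_integral_cong_AE)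
      \<comment> \<open>The two centres, where \<open>bessel_f\<close> takes its junk value, form a
        null set.\<close>
      have eq: "4 * ennreal (?f \<xi> x * ?f \<eta> x) =
          bessel_int \<mu> ((norm (x - \<xi>))\<^sup>2) (a\<^sup>2) * bessel_int \<mu> ((norm (x - \<eta>))\<^sup>2) (a\<^sup>2)"
        if "x \<noteq> \<xi>" "x \<noteq> \<eta>" for x
      proof -
        have "4 * ennreal (?f \<xi> x * ?f \<eta> x) = ennreal (4 * (?f \<xi> x * ?f \<eta> x))"
          by (subst ennreal_mult') auto
        also have "4 * (?f \<xi> x * ?f \<eta> x) = (2 * bessel_f a \<mu> (x - \<xi>)) * (2 * bessel_f a \<mu> (x - \<eta>))"
          by (simp add: bessel_f_shift_def)
        also have "ennreal \<dots> = ennreal (2 * bessel_f a \<mu> (x - \<xi>)) * ennreal (2 * bessel_f a \<mu> (x - \<eta>))"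
          by (rule ennreal_mult') (simp add: bessel_f_nonneg)
        finally show ?thesis
          using assms that by (simp only: bessel_int_eq_bessel_f right_minus_eq not_False_eq_True)
      qed
      show "AE x in lborel. 4 * ennreal (?f \<xi> x * ?f \<eta> x) =
          bessel_int \<mu> ((norm (x - \<xi>))\<^sup>2) (a\<^sup>2) * bessel_int \<mu> ((norm (x - \<eta>))\<^sup>2) (a\<^sup>2)"
        using AE_lborel_singleton[of \<xi>] AE_lborel_singleton[of \<eta>] by eventually_elim (rule eq)
    qed
    also have "\<dots> = ennreal C * bessel_int p (a\<^sup>2) ((norm (\<xi> - \<eta>))\<^sup>2)"
      using nn_integral_bessel_int_product[where 'a = "real ^ 'n" and \<mu> = \<mu> and a = a and \<xi> = \<xi> and \<eta> = \<eta>] \<alpha> assms(5)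
      by (simp add: C_def \<alpha>_def n_def)
    finally show ?thesis .
  qed
  have finite: "bessel_int p (a\<^sup>2) d < \<infinity>" if "d \<ge> 0" for d
    using bessel_int_finite p assms(4) that by simp
  have integral_finite: "(\<integral>\<^sup>+x. ennreal (?f \<xi> x * ?f \<eta> x) \<partial>lborel) < \<infinity>" for \<xi> \<eta>
  proof -
    have "4 * (\<integral>\<^sup>+x. ennreal (?f \<xi> x * ?f \<eta> x) \<partial>lborel) < \<infinity>"
      unfolding inner using finite by (simp add: ennreal_mult_less_top)
    then show ?thesis
      by (auto simp: ennreal_mult_less_top)
  qed
  \<comment> \<open>Square integrability is the case of equal centres in
    \<open>integral_finite\<close>, which rests on p > 0, that is, \<mu> < n/4.\<close>
  have L2: "L2_fun (?f \<xi>)" for \<xi>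
    unfolding L2_fun_def
  proof
    show "integrable lborel (\<lambda>x. (?f \<xi> x)\<^sup>2)"
      using integral_finite[of \<xi> \<xi>] by (intro integrableI_nonneg) (auto simp: power2_eq_square)
  qed measurable
  have L2_inner: "L2_inner (?f \<xi>) (?f \<eta>) = C / 4 * enn2real (bessel_int p (a\<^sup>2) ((norm (\<xi> - \<eta>))\<^sup>2))" for \<xi> \<eta>
  proof -
    have "L2_inner (?f \<xi>) (?f \<eta>) = enn2real (\<integral>\<^sup>+x. ennreal (?f \<xi> x * ?f \<eta> x) \<partial>lborel)"
      unfolding L2_inner_def by (rule integral_eq_nn_integral) (auto simp: f_nonneg)
    moreover have "4 * enn2real (\<integral>\<^sup>+x. ennreal (?f \<xi> x * ?f \<eta> x) \<partial>lborel) =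
        C * enn2real (bessel_int p (a\<^sup>2) ((norm (\<xi> - \<eta>))\<^sup>2))"
      using arg_cong[OF inner[of \<xi> \<eta>], of enn2real] C by (simp add: enn2real_mult)
    ultimately show ?thesis by simp
  qed
  \<comment> \<open>The powers of 2 have exponents p, n/2 and 1 - 2\<alpha> with sum 1; division by
    4 leaves 1/2, matching the factor 2 between the two-weight integral and K.\<close>
  have const: "2 powr (n / 2 - 2 * \<mu>) / (pi powr (n / 2) * Beta (n / 2 - \<mu>) (1 / 2)) * (C / 4) = 1 / 2"
  proof -
    have "Beta \<alpha> (1 / 2) > 0"
      using \<alpha> by (intro Beta_pos) auto
    moreover have "2 powr (n / 2 - 2 * \<mu>) * (2 powr (n / 2) * 2 powr (1 - 2 * \<alpha>)) = (2 :: real)"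
      by (simp add: powr_add[symmetric] \<alpha>_def)
    ultimately show ?thesis
      unfolding C_def Beta_duplication[OF \<alpha>] \<alpha>_def[symmetric]
      by (simp add: powr_mult field_simps)
  qed
  define R where "R \<xi> \<eta> = 2 powr (n / 2 - 2 * \<mu>) / (pi powr (n / 2) * Beta (n / 2 - \<mu>) (1 / 2)) *
      L2_inner (?f \<xi>) (?f \<eta>)" for \<xi> \<eta>
  have R: "R \<xi> \<eta> = enn2real (bessel_int p (a\<^sup>2) ((norm (\<xi> - \<eta>))\<^sup>2)) / 2" for \<xi> \<eta>
    unfolding R_def L2_inner mult.assoc[symmetric] const by simp
  \<comment> \<open>The conversion to K is used with a and r exchanged, which inverts the quotient
    in the power.\<close>
  have K: "(r / a) powr p * bessel_K p (a * r) = enn2real (bessel_int p (a\<^sup>2) (r\<^sup>2)) / 2" if "r > 0" for r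
    using bessel_int_eq_powr_bessel_K[of r a p] that assms(4) p
    by (simp add: bessel_K_nonneg mult.commute)
  have "(\<xi> \<noteq> \<eta> \<longrightarrow> (norm (\<xi> - \<eta>) / a) powr p * bessel_K p (a * norm (\<xi> - \<eta>)) = R \<xi> \<eta>) \<and>
      (\<xi> = \<eta> \<longrightarrow> ((\<lambda>r. (r / a) powr p * bessel_K p (a * r)) \<longlongrightarrow> R \<xi> \<eta>) (at_right 0))" for \<xi> \<eta>
  proof (intro conjI impI)
    assume "\<xi> \<noteq> \<eta>"
    then show "(norm (\<xi> - \<eta>) / a) powr p * bessel_K p (a * norm (\<xi> - \<eta>)) = R \<xi> \<eta>"
      unfolding R by (intro K) simp
  next
    assume [simp]: "\<xi> = \<eta>"
    have "((\<lambda>r. enn2real (bessel_int p (a\<^sup>2) (r\<^sup>2)) / 2) \<longlongrightarrow> enn2real (bessel_int p (a\<^sup>2) 0) / 2) (at_right 0)"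
      using p assms(4) by (intro tendsto_divide bessel_int_tendsto tendsto_const) auto
    moreover have "\<forall>\<^sub>F r in at_right 0. enn2real (bessel_int p (a\<^sup>2) (r\<^sup>2)) / 2 = (r / a) powr p * bessel_K p (a * r)"
      using eventually_at_right_less[of 0] by eventually_elim (simp add: K)
    ultimately show "((\<lambda>r. (r / a) powr p * bessel_K p (a * r)) \<longlongrightarrow> R \<xi> \<eta>) (at_right 0)"
      unfolding R by (simp add: tendsto_cong)
  qed
  then show ?thesis
    using p L2 by (simp add: Let_def R_def n_def)
qed

end
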